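(* There is a constant $c>0$ such that for every simply connected domain $\Omega\subset\mathbb{C}$ and all $p,q\in\Omega$, $$c\, d_\Omega(p,q)\le X(p,q)\le d_\Omega(p,q),$$ where $X(p,q):=\sup\{|f(p)-f(q)| : f:\Omega\to\mathbb{C}\text{ analytic},\ |f'(z)|\le 1 \text{ for all } z\in\Omega\}$.
   Context: A domain is a nonempty connected open subset of $\mathbb{C}$. For a domain $\Omega\subset\mathbb{C}$ and $p,q\in\Omega$, the interior path metric $d_\Omega(p,q)$ is the infimum of the (Euclidean) lengths of rectifiable curves lying entirely in $\Omega$ and joining $p$ to $q$. The constant $c$ is absolute: it does not depend on $\Omega$, $p$ or $q$. *)

theory Defs
  imports "HOL-Analysis.Analysis"
begin

text \<open>
  Infima and suprema are taken in \<^typ>\<open>ereal\<close>, so that they never take unspecified values; the infimum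
  over an empty set of curves would be \<open>\<infinity>\<close>.
\<close>

definition is_domain :: "complex set \<Rightarrow> bool" where
  "is_domain \<Omega> \<longleftrightarrow> \<Omega> \<noteq> {} \<and> connected \<Omega> \<and> open \<Omega>"

definition partition_points :: "nat \<Rightarrow> (nat \<Rightarrow> real) \<Rightarrow> bool" where
  "partition_points n t \<longleftrightarrow> t 0 = 0 \<and> t n = 1 \<and> (\<forall>i<n. t i \<le> t (Suc i))"

definition curve_length :: "(real \<Rightarrow> complex) \<Rightarrow> ereal" where
  "curve_length g =
     Sup {ereal (\<Sum>i<n. dist (g (t i)) (g (t (Suc i)))) | n t. partition_points n t}"

definition rectifiable :: "(real \<Rightarrow> complex) \<Rightarrow> bool" where
  "rectifiable g \<longleftrightarrow> path g \<and> curve_length g < \<infinity>"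

definition interior_dist :: "complex set \<Rightarrow> complex \<Rightarrow> complex \<Rightarrow> ereal" where
  "interior_dist \<Omega> p q =
     Inf {curve_length g | g. rectifiable g \<and> path_image g \<subseteq> \<Omega> \<and>
                              pathstart g = p \<and> pathfinish g = q}"

definition analytic_dist :: "complex set \<Rightarrow> complex \<Rightarrow> complex \<Rightarrow> ereal" where
  "analytic_dist \<Omega> p q =
     Sup {ereal (cmod (f p - f q)) | f. f analytic_on \<Omega> \<and> (\<forall>z\<in>\<Omega>. cmod (deriv f z) \<le> 1)}"

end

theory Submission
  imports Defs "HOL-Complex_Analysis.Riemann_Mapping"
begin

text \<open>
  The upper bound holds because \<open>f\<close> is locally 1-Lipschitz. For the lower bound with \<open>\<Omega> \<noteq> \<complex>\<close>, let \<open>\<psi>\<close>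
  map the strip \<open>\<bar>Im w\<bar> < \<pi>/2\<close> conformally onto \<open>\<Omega>\<close> with \<open>\<psi> 0 = p\<close> and \<open>\<psi> R = q\<close>, \<open>R \<ge> 0\<close>, and write
  \<open>\<psi>' = \<bar>\<psi>'\<bar> e\<^sup>i\<^sup>\<theta>\<close> on the real line. Since \<open>\<bar>\<psi>'' / \<psi>'\<bar>\<close> is bounded there by an absolute constant \<open>C\<close>, \<open>\<theta>\<close> is
  \<open>C\<close>-Lipschitz, so smoothing \<open>e\<^sup>-\<^sup>i\<^sup>\<theta>\<close> with a sufficiently narrow Gaussian gives a holomorphic \<open>H\<close> which is
  bounded on the strip and satisfies \<open>Re (H e\<^sup>i\<^sup>\<theta>) \<ge> \<kappa> > 0\<close> on \<open>[0, R]\<close>. The primitive \<open>f\<close> of \<open>H \<circ> \<psi>\<^sup>-\<^sup>1\<close> then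
  has bounded derivative, and \<open>\<bar>f q - f p\<bar> \<ge> Re \<integral> H \<psi>' \<ge> \<kappa> \<integral> \<bar>\<psi>'\<bar>\<close> over \<open>[0, R]\<close>, where the last integral is
  the length of a curve from \<open>p\<close> to \<open>q\<close> and hence at least \<open>d\<^sub>\<Omega>(p,q)\<close>.
\<close>

section \<open>Distortion of univalent functions on a unit disc\<close>

text \<open>
  A univalent \<open>f\<close> omits some \<open>a\<close> at distance at most \<open>3 \<bar>f' x\<bar>\<close> from \<open>f x\<close>. Let \<open>Q\<^sup>2 = (f - a) / (f x - a)\<close>
  with \<open>Q x = -1\<close>. By univalence \<open>Q\<close> omits not only \<open>0\<close> but also \<open>1\<close>, so Schottky's theorem bounds \<open>Q\<close>,
  hence \<open>f\<close>, near \<open>x\<close>.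
\<close>
lemma univalent_deriv2_bound:
  obtains C :: real where "C > 0"
    "\<And>f x. f holomorphic_on ball x 1 \<Longrightarrow> inj_on f (ball x 1) \<Longrightarrow>
       cmod (deriv (deriv f) x) \<le> C * cmod (deriv f x)"
proof -
  \<comment> \<open>Schottky's bound for a function on the closed unit disc that omits 0 and 1, with
    modulus at most 1 at the centre, evaluated at points of modulus at most 1/2.\<close>
  define M where "M = exp (pi * exp (pi * (2 + 2 * 1 + 12 * (1/2) / (1 - 1/2))))"
  have bound: "cmod (deriv (deriv f) x) \<le> 2 * (3 * (M\<^sup>2 + 2)) / (1/4)^2 * cmod (deriv f x)"
    if hol: "f holomorphic_on ball x 1" and inj: "inj_on f (ball x 1)" for f x
  proof -
    define d where "d = cmod (deriv f x)"
    have "deriv f x \<noteq> 0"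
      using holomorphic_injective_imp_regular[OF hol open_ball inj] by simp
    then have d: "d > 0" by (simp add: d_def)
    \<comment> \<open>A weak form of Koebe's theorem. Otherwise the inverse \<open>g\<close> would
      map the disc of radius \<open>2 * d\<close> about \<open>f x\<close> into a unit disc, so
      Cauchy's estimate would give |g'(f x)| \<le> 1/(2d), although |g'(f x)| = 1/d.\<close>
    have "\<not> ball (f x) (3 * d) \<subseteq> f ` ball x 1"
    proof
      assume sub: "ball (f x) (3 * d) \<subseteq> f ` ball x 1"
      obtain g where g: "g holomorphic_on f ` ball x 1"
        "\<And>z. z \<in> ball x 1 \<Longrightarrow> deriv f z * deriv g (f z) = 1"
        "\<And>z. z \<in> ball x 1 \<Longrightarrow> g (f z) = z"
        using holomorphic_has_inverse[OF hol open_ball inj] by metis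
      have sub2: "cball (f x) (2 * d) \<subseteq> f ` ball x 1"
      proof -
        have "cball (f x) (2 * d) \<subseteq> ball (f x) (3 * d)"
          using d by (simp add: cball_subset_ball_iff)
        with sub show ?thesis by blast
      qed
      have "cmod ((deriv ^^ 1) g (f x)) \<le> fact 1 * 1 / (2 * d) ^ 1"
      proof (rule Cauchy_higher_deriv_bound)
        show "g holomorphic_on ball (f x) (2 * d)"
          using g(1) sub2 ball_subset_cball holomorphic_on_subset by blast
        show "continuous_on (cball (f x) (2 * d)) g"
          using g(1) sub2 holomorphic_on_imp_continuous_on holomorphic_on_subset by blast
        fix w assume "w \<in> ball (f x) (2 * d)"
        then have "w \<in> f ` ball x 1"
          using sub2 ball_subset_cball by blast
        then show "g w \<in> ball x 1"
          using g(3) by auto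
      qed (use d in auto)
      then have "cmod (deriv g (f x)) \<le> 1 / (2 * d)" by simp
      moreover have "d * cmod (deriv g (f x)) = 1"
        using g(2)[of x] by (metis centre_in_ball d_def norm_mult norm_one zero_less_one)
      ultimately show False
        using d by (simp add: field_simps)
    qed
    then obtain a where a: "a \<in> ball (f x) (3 * d)" "a \<notin> f ` ball x 1"
      by blast
    have nz: "f z - a \<noteq> 0" if "z \<in> ball x 1" for z
      using a(2) that by auto
    define k where "k z = (f z - a) / (f x - a)" for z
    have "k holomorphic_on ball x 1"
      unfolding k_def using nz by (intro holomorphic_intros hol) auto
    moreover have "k z \<noteq> 0" if "z \<in> ball x 1" for z
      using nz[OF that] nz[of x] by (simp add: k_def)
    ultimately obtain G where G: "G holomorphic_on ball x 1"
      "\<And>z. z \<in> ball x 1 \<Longrightarrow> k z = (G z)\<^sup>2"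
      using simply_connected_eq_holomorphic_sqrt[OF open_ball, of x 1]
            convex_imp_simply_connected[OF convex_ball] by metis
    \<comment> \<open>\<open>G x\<close> is 1 or -1, because \<open>k x = 1\<close>; the quotient by
      \<open>- G x\<close> selects the branch with value -1 at \<open>x\<close>.\<close>
    define Q where "Q z = - G z / G x" for z
    have "k x = 1" using nz[of x] by (simp add: k_def)
    then have Gx: "(G x)\<^sup>2 = 1" using G(2)[of x] by simp
    then have Gx0: "G x \<noteq> 0" by auto
    have Q: "Q holomorphic_on ball x 1" "Q x = -1" "\<And>z. z \<in> ball x 1 \<Longrightarrow> k z = (Q z)\<^sup>2"
      using G Gx0 Gx unfolding Q_def by (auto intro!: holomorphic_intros simp: power_divide)
    have Q01: "Q z \<noteq> 0 \<and> Q z \<noteq> 1" if z: "z \<in> ball x 1" for z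
    proof
      show "Q z \<noteq> 0" using Q(3)[OF z] nz[OF z] nz[of x] by (auto simp: k_def)
      show "Q z \<noteq> 1"
      proof
        assume "Q z = 1"
        with Q(3)[OF z] nz[of x] have "f z = f x" by (simp add: k_def)
        then have "z = x" using inj z by (auto dest: inj_onD)
        with Q(2) \<open>Q z = 1\<close> show False by simp
      qed
    qed
    have QM: "cmod (Q z) \<le> M" if z: "z \<in> cball x (1/4)" for z
    proof -
      \<comment> \<open>Halving the scale puts the closed unit disc inside the domain of
        \<open>Q\<close>; the points of modulus at most 1/2 then correspond to
        \<open>cball x (1/4)\<close>.\<close>
      define F where "F w = Q (x + w / 2)" for w
      have F: "F holomorphic_on cball 0 1"
        unfolding F_def
        by (rule holomorphic_on_compose_gen[OF _ Q(1), unfolded o_def, where f = "\<lambda>w. x + w / 2"])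
           (auto intro!: holomorphic_intros simp: dist_norm)
      have inb: "x + w / 2 \<in> ball x 1" if "w \<in> cball 0 1" for w :: complex
        using that by (auto simp: dist_norm norm_divide)
      have "cmod (F (2 * (z - x))) \<le> M"
        unfolding M_def
      proof (rule Schottky[OF F])
        show "cmod (F 0) \<le> 1" by (simp add: F_def Q(2))
        show "\<not> (F w = 0 \<or> F w = 1)" if "w \<in> cball 0 1" for w
          using Q01[OF inb[OF that]] by (simp add: F_def)
        show "cmod (2 * (z - x)) \<le> 1/2"
          using z by (subst norm_mult) (simp add: dist_norm norm_minus_commute)
      qed auto
      then show ?thesis by (simp add: F_def diff_divide_distrib)
    qed
    have ax: "cmod (f x - a) < 3 * d" using a(1) by (simp add: dist_norm)
    have "cmod ((deriv ^^ 2) f x) \<le> fact 2 * (3 * d * (M\<^sup>2 + 2)) / (1/4)^2"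
    proof (rule Cauchy_higher_deriv_bound)
      show "f holomorphic_on ball x (1/4)"
        using hol by (rule holomorphic_on_subset) auto
      show "continuous_on (cball x (1/4)) f"
        using holomorphic_on_imp_continuous_on[OF hol] by (rule continuous_on_subset) auto
      fix w assume w: "w \<in> ball x (1/4)"
      then have w1: "w \<in> ball x 1" by auto
      have "f w - f x = (f x - a) * ((Q w)\<^sup>2 - 1)"
        using Q(3)[OF w1] nz[of x] by (simp add: k_def field_simps)
      then have "cmod (f w - f x) = cmod (f x - a) * cmod ((Q w)\<^sup>2 - 1)"
        by (simp add: norm_mult)
      also have "cmod ((Q w)\<^sup>2 - 1) \<le> M\<^sup>2 + 1"
        using QM[of w] w norm_triangle_ineq4[of "(Q w)\<^sup>2" 1]
          power_mono[of "cmod (Q w)" M 2] by (simp add: norm_power)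
      then have "cmod (f x - a) * cmod ((Q w)\<^sup>2 - 1) \<le> 3 * d * (M\<^sup>2 + 1)"
        using ax d by (intro mult_mono) auto
      \<comment> \<open>The extra 1 makes the inequality strict: the Cauchy estimate asks for values
        in an open ball.\<close>
      also have "\<dots> < 3 * d * (M\<^sup>2 + 2)" using d by simp
      finally show "f w \<in> ball (f x) (3 * d * (M\<^sup>2 + 2))"
        by (simp add: dist_norm norm_minus_commute)
    qed auto
    then show ?thesis
      by (simp add: numeral_2_eq_2 d_def algebra_simps)
  qed
  show ?thesis
    by (rule that[OF _ bound]) (auto intro!: divide_pos_pos add_nonneg_pos)
qed

section \<open>The strip and its Riemann map\<close>

text \<open>With this width \<open>exp\<close> maps the strip bijectively onto the right half-plane,
  with inverse \<open>Ln\<close>.\<close>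

definition strip :: "complex set" where
  "strip = {w. \<bar>Im w\<bar> < pi / 2}"

lemma convex_strip: "convex strip" and open_strip: "open strip"
proof -
  have eq: "strip = {w. Im w < pi / 2} \<inter> {w. Im w > - (pi / 2)}"
    by (auto simp: strip_def abs_less_iff)
  show "convex strip"
    unfolding eq by (intro convex_Int convex_halfspace_Im_lt convex_halfspace_Im_gt)
  show "open strip"
    unfolding eq by (intro open_Int open_halfspace_Im_lt open_halfspace_Im_gt)
qed

lemma of_real_in_strip [simp]: "of_real x \<in> strip"
  by (simp add: strip_def)

text \<open>The half-width pi/2 exceeds 1, so the estimate for univalent functions on unit discs
  applies at every real point.\<close>

lemma ball_of_real_subset_strip: "ball (of_real x) 1 \<subseteq> strip"
proof
  fix w :: complex assume "w \<in> ball (of_real x) 1"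
  then have "cmod (w - of_real x) < 1" by (simp add: dist_norm norm_minus_commute)
  then have "\<bar>Im w\<bar> < 1" using abs_Im_le_cmod[of "w - of_real x"] by simp
  then show "w \<in> strip" using pi_gt3 by (simp add: strip_def)
qed

text \<open>The real part equals (1 - |z|^2) / |1 - z|^2.\<close>

lemma Re_Cayley_pos:
  assumes "cmod z < 1"
  shows "Re ((1 + z) / (1 - z)) > 0"
proof -
  have z1: "z \<noteq> 1" using assms by auto
  have "(Re z)\<^sup>2 + (Im z)\<^sup>2 < 1"
    using assms by (simp add: cmod_def)
  moreover have "(1 - Re z)\<^sup>2 + (Im z)\<^sup>2 > 0"
    using z1 by (smt (verit) complex_eqI diff_eq_diff_less eq_iff_diff_eq_0 one_complex.sel power2_eq_iff_nonneg sum_power2_gt_zero_iff)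
  ultimately show ?thesis
    by (simp add: Re_divide power2_eq_square algebra_simps)
qed

text \<open>A point of the right half-plane is closer to 1 than to -1.\<close>

lemma cmod_Cayley_less_one:
  assumes "Re v > 0"
  shows "cmod ((v - 1) / (v + 1)) < 1"
proof -
  have "v + 1 \<noteq> 0" using assms by (auto simp: complex_eq_iff)
  moreover have "cmod (v - 1) < cmod (v + 1)"
    using assms by (simp add: cmod_def power2_eq_square algebra_simps)
  ultimately show ?thesis by (simp add: norm_divide)
qed

text \<open>A Riemann map onto the disc is followed by an automorphism taking the image of
  \<open>p\<close> to 0 and by a rotation taking the image of \<open>q\<close> into [0, 1). The
  logarithm of the Cayley transform then carries the disc to the strip, fixes 0 and sends [0, 1) to
  the nonnegative reals.\<close>

lemma Riemann_map_strip:
  assumes "open \<Omega>" "simply_connected \<Omega>" "\<Omega> \<noteq> UNIV" "p \<in> \<Omega>" "q \<in> \<Omega>"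
  obtains \<sigma> \<psi> :: "complex \<Rightarrow> complex" and R :: real
  where "\<sigma> holomorphic_on \<Omega>" "\<psi> holomorphic_on strip"
    "\<And>z. z \<in> \<Omega> \<Longrightarrow> \<sigma> z \<in> strip \<and> \<psi> (\<sigma> z) = z"
    "\<And>w. w \<in> strip \<Longrightarrow> \<psi> w \<in> \<Omega> \<and> \<sigma> (\<psi> w) = w"
    "R \<ge> 0" "\<psi> 0 = p" "\<psi> (of_real R) = q"
proof -
  obtain f g where f: "f holomorphic_on \<Omega>" and g: "g holomorphic_on ball 0 1"
    and fg: "\<And>z. z \<in> \<Omega> \<Longrightarrow> f z \<in> ball 0 1 \<and> g (f z) = z"
            "\<And>z. z \<in> ball 0 1 \<Longrightarrow> g z \<in> \<Omega> \<and> f (g z) = z"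
    using Riemann_mapping_theorem[of \<Omega>] assms by blast
  obtain F G where FG: "F (f p) = 0" "F holomorphic_on ball 0 1" "F ` ball 0 1 \<subseteq> ball 0 1"
    "G holomorphic_on ball 0 1" "G ` ball 0 1 \<subseteq> ball 0 1"
    "\<And>z. z \<in> ball 0 1 \<Longrightarrow> F (G z) = z" "\<And>z. z \<in> ball 0 1 \<Longrightarrow> G (F z) = z"
    using ball_biholomorphism_exists fg(1)[OF \<open>p \<in> \<Omega>\<close>] by metis
  define b where "b = F (f q)"
  \<comment> \<open>The rotation that makes \<open>b\<close> real and nonnegative; for
    \<open>b = 0\<close> any unimodular value would do.\<close>
  define u where "u = (if b = 0 then 1 else of_real (cmod b) / b)"
  have u: "cmod u = 1" "u * b = of_real (cmod b)"
    by (auto simp: u_def norm_divide)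
  then have u0: "u \<noteq> 0" by auto
  define \<mu> where "\<mu> z = u * F (f z)" for z
  have \<mu>: "cmod (\<mu> z) < 1" if "z \<in> \<Omega>" for z
    using FG(3) fg(1)[OF that] u by (auto simp: \<mu>_def norm_mult image_subset_iff)
  have \<mu>1: "\<mu> z \<noteq> 1" if "z \<in> \<Omega>" for z using \<mu>[OF that] by auto
  have hol\<mu>: "\<mu> holomorphic_on \<Omega>"
    unfolding \<mu>_def using fg(1)
    by (intro holomorphic_intros holomorphic_on_compose_gen[OF f FG(2), unfolded o_def]) auto
  define \<sigma> where "\<sigma> z = Ln ((1 + \<mu> z) / (1 - \<mu> z))" for z
  have Re_pos: "Re ((1 + \<mu> z) / (1 - \<mu> z)) > 0" if "z \<in> \<Omega>" for z
    by (rule Re_Cayley_pos[OF \<mu>[OF that]])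
  have ne: "(1 + \<mu> z) / (1 - \<mu> z) \<noteq> 0" if "z \<in> \<Omega>" for z
    using Re_pos[OF that] by force
  \<comment> \<open>This is tanh(w/2), the inverse of the logarithm of the Cayley transform.\<close>
  define t where "t w = (exp w - 1) / (exp w + 1 :: complex)" for w
  have exp_pos: "Re (exp w) > 0" if "w \<in> strip" for w
    using that by (auto simp: Re_exp strip_def intro!: mult_pos_pos cos_gt_zero_pi)
  have t: "cmod (t w) < 1" if "w \<in> strip" for w
    unfolding t_def by (rule cmod_Cayley_less_one[OF exp_pos[OF that]])
  have exp1: "exp w + 1 \<noteq> 0" if "w \<in> strip" for w
    using exp_pos[OF that] by (auto simp: complex_eq_iff)
  \<comment> \<open>The construction of \<open>\<sigma>\<close> run backwards; \<open>cnj u\<close>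
    undoes the rotation since |u| = 1.\<close>
  define \<psi> where "\<psi> w = g (G (cnj u * t w))" for w
  have ut: "cnj u * t w \<in> ball 0 1" if "w \<in> strip" for w
    using t[OF that] u by (simp add: norm_mult)
  have Gut: "G (cnj u * t w) \<in> ball 0 1" if "w \<in> strip" for w
    using FG(5) ut[OF that] by blast
  have uu: "u * cnj u = 1" using u(1) complex_norm_square[of u] by simp
  have t_sigma: "t (\<sigma> z) = \<mu> z" if "z \<in> \<Omega>" for z
    using \<mu>1[OF that] ne[OF that] by (simp add: t_def \<sigma>_def field_simps)
  have 1: "\<sigma> holomorphic_on \<Omega>"
    unfolding \<sigma>_def
  proof (intro holomorphic_intros hol\<mu>)
    show "(1 + \<mu> z) / (1 - \<mu> z) \<notin> \<real>\<^sub>\<le>\<^sub>0" if "z \<in> \<Omega>" for z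
      using Re_pos[OF that] by (auto simp: complex_nonpos_Reals_iff)
  qed (use \<mu>1 in auto)
  have 2: "\<psi> holomorphic_on strip"
    unfolding \<psi>_def
  proof (rule holomorphic_on_compose_gen[OF _ g, unfolded o_def])
    show "(\<lambda>w. G (cnj u * t w)) holomorphic_on strip"
      by (rule holomorphic_on_compose_gen[OF _ FG(4), unfolded o_def])
         (use exp1 ut in \<open>auto simp: t_def intro!: holomorphic_intros\<close>)
  qed (use Gut in auto)
  have 3: "\<sigma> z \<in> strip \<and> \<psi> (\<sigma> z) = z" if "z \<in> \<Omega>" for z
  proof
    show "\<sigma> z \<in> strip"
      using Re_Ln_pos_lt[OF ne[OF that]] Re_pos[OF that] by (simp add: strip_def \<sigma>_def)
    have "cnj u * \<mu> z = F (f z)"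
      using uu by (simp add: \<mu>_def mult.assoc[symmetric] mult.commute)
    then show "\<psi> (\<sigma> z) = z"
      using t_sigma[OF that] FG(7) fg(1)[OF that] by (simp add: \<psi>_def)
  qed
  have 4: "\<psi> w \<in> \<Omega> \<and> \<sigma> (\<psi> w) = w" if w: "w \<in> strip" for w
  proof
    show "\<psi> w \<in> \<Omega>" using fg(2)[OF Gut[OF w]] by (simp add: \<psi>_def)
    have "F (f (\<psi> w)) = cnj u * t w"
      unfolding \<psi>_def using fg(2)[OF Gut[OF w]] FG(6)[OF ut[OF w]] by simp
    then have "\<mu> (\<psi> w) = t w"
      using uu by (simp add: \<mu>_def mult.assoc[symmetric])
    moreover have "(1 + t w) / (1 - t w) = exp w"
    proof -
      have "1 + t w = 2 * exp w / (exp w + 1)" "1 - t w = 2 / (exp w + 1)"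
        using exp1[OF w] by (simp_all add: t_def field_simps)
      then show ?thesis using exp1[OF w] by simp
    qed
    moreover have "Ln (exp w) = w"
      using w by (intro Ln_exp) (auto simp: strip_def)
    ultimately show "\<sigma> (\<psi> w) = w" by (simp add: \<sigma>_def)
  qed
  define R where "R = ln ((1 + cmod b) / (1 - cmod b))"
  have b1: "cmod b < 1" using \<mu>[OF \<open>q \<in> \<Omega>\<close>] u(1) by (simp add: \<mu>_def b_def norm_mult)
  have "\<mu> p = 0" using FG(1) by (simp add: \<mu>_def)
  then have "\<sigma> p = 0" by (simp add: \<sigma>_def)
  have "\<mu> q = of_real (cmod b)" using u(2) by (simp add: \<mu>_def b_def)
  then have "\<sigma> q = Ln (of_real ((1 + cmod b) / (1 - cmod b)))"
    by (simp add: \<sigma>_def)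
  also have "\<dots> = of_real R"
    unfolding R_def using b1 by (intro Ln_of_real) (auto intro!: divide_pos_pos add_pos_nonneg)
  finally have "\<sigma> q = of_real R" .
  have "R \<ge> 0" unfolding R_def using b1 by (simp add: field_simps)
  show ?thesis
    by (rule that[OF 1 2 3 4 \<open>R \<ge> 0\<close>])
       (use 3 \<open>p \<in> \<Omega>\<close> \<open>q \<in> \<Omega>\<close> \<open>\<sigma> p = 0\<close> \<open>\<sigma> q = of_real R\<close> in metis)+
qed

section \<open>Gaussian smoothing of the phase\<close>

lemma cos_ge_one_minus_half_square: "cos u \<ge> 1 - u\<^sup>2 / 2" for u :: real
proof -
  have "cos u = 1 - 2 * (sin (u / 2))\<^sup>2"
    using cos_double_sin[of "u / 2"] by simp
  moreover have "(sin (u / 2))\<^sup>2 \<le> (u / 2)\<^sup>2"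
    by (metis abs_ge_zero abs_sin_x_le_abs_x power2_abs power_mono)
  ultimately show ?thesis by (simp add: power_divide)
qed

text \<open>Serves to bound a Gaussian average of cos(\<theta> x - \<theta> s) from below: the
  factor 1 - A (s - x)^2 will minorize the cosine. It becomes negative far from \<open>x\<close>, so
  positivity of the integral needs an argument.\<close>

lemma gaussian_moment_lower:
  fixes A x a b :: real
  assumes "a \<le> x - 1" "x + 1 \<le> b" "A \<ge> 0"
  shows "integral {a..b} (\<lambda>s. exp (- A * (s - x)\<^sup>2) * (1 - A * (s - x)\<^sup>2)) \<ge> exp (- A)"
proof -
  let ?E = "\<lambda>s. exp (- A * (s - x)\<^sup>2)"
  define D where "D = (b - x) * ?E b - (a - x) * ?E a"
  have cont: "continuous_on T ?E" for T by (intro continuous_intros)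
  \<comment> \<open>\<open>2 E (1 - A (s - x)\<^sup>2) = E + ((s - x) E)'\<close>, and the boundary term \<open>D\<close> is nonnegative.\<close>
  have "((\<lambda>s. ?E s * (1 - 2 * A * (s - x)\<^sup>2)) has_integral D) {a..b}"
    unfolding D_def
  proof (rule fundamental_theorem_of_calculus)
    fix s assume "s \<in> {a..b}"
    show "((\<lambda>s. (s - x) * ?E s) has_vector_derivative ?E s * (1 - 2 * A * (s - x)\<^sup>2)) (at s within {a..b})"
      unfolding has_real_derivative_iff_has_vector_derivative[symmetric]
      by (auto intro!: derivative_eq_intros simp: algebra_simps power2_eq_square)
  qed (use assms in auto)
  moreover have D: "D \<ge> 0"
    unfolding D_def using assms by (simp add: mult_nonpos_nonneg order_trans[of _ 0])
  moreover have "(?E has_integral integral {a..b} ?E) {a..b}"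
    using cont by (intro integrable_integral integrable_continuous_interval)
  ultimately have "((\<lambda>s. 1/2 * (?E s * (1 - 2 * A * (s - x)\<^sup>2)) + 1/2 * ?E s) has_integral
      1/2 * D + 1/2 * integral {a..b} ?E) {a..b}"
    by (intro has_integral_add has_integral_mult_right)
  moreover have "(\<lambda>s. 1/2 * (?E s * (1 - 2 * A * (s - x)\<^sup>2)) + 1/2 * ?E s) =
      (\<lambda>s. ?E s * (1 - A * (s - x)\<^sup>2))"
    by (auto simp: algebra_simps)
  ultimately have "integral {a..b} (\<lambda>s. ?E s * (1 - A * (s - x)\<^sup>2)) =
      1/2 * D + 1/2 * integral {a..b} ?E"
    by (metis (no_types, lifting) integral_unique)
  \<comment> \<open>On the window of length 2 about \<open>x\<close> the Gaussian is at least
    \<open>exp (- A)\<close>; the factor 1/2 leaves exactly \<open>exp (- A)\<close>.\<close>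
  moreover have "integral {a..b} ?E \<ge> integral {x - 1..x + 1} ?E"
    using assms by (intro integral_subset_le integrable_continuous_interval cont) auto
  moreover have "integral {x - 1..x + 1} ?E \<ge> integral {x - 1..x + 1} (\<lambda>s. exp (- A))"
  proof (intro integral_le integrable_continuous_interval cont)
    fix s assume "s \<in> {x - 1..x + 1}"
    then have "\<bar>s - x\<bar> \<le> 1" by (simp add: abs_le_iff)
    then have "(s - x)\<^sup>2 \<le> 1" by (simp add: abs_square_le_1)
    then have "A * (s - x)\<^sup>2 \<le> A" using assms(3) by (simp add: mult_left_le)
    then show "exp (- A) \<le> ?E s" by simp
  qed auto
  moreover have "integral {x - 1..x + 1} (\<lambda>s. exp (- A)) = 2 * exp (- A)" by simp
  ultimately show ?thesis
    using D by linarith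
qed

text \<open>Comparison with 1 / (1 + u^2), whose integral over any interval is at most pi; the bound
  is uniform in \<open>x\<close>, \<open>a\<close> and \<open>b\<close>.\<close>

lemma gaussian_integral_upper:
  fixes A x a b :: real
  assumes "a \<le> b" "A \<ge> 1"
  shows "integral {a..b} (\<lambda>s. exp (- A * (s - x)\<^sup>2)) \<le> pi"
proof -
  let ?E = "\<lambda>s. exp (- A * (s - x)\<^sup>2)"
  have hi: "((\<lambda>s. 1 / (1 + (s - x)\<^sup>2)) has_integral arctan (b - x) - arctan (a - x)) {a..b}"
  proof (rule fundamental_theorem_of_calculus)
    fix s assume "s \<in> {a..b}"
    show "((\<lambda>s. arctan (s - x)) has_vector_derivative 1 / (1 + (s - x)\<^sup>2)) (at s within {a..b})"
      unfolding has_real_derivative_iff_has_vector_derivative[symmetric]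
      by (auto intro!: derivative_eq_intros simp: field_simps)
  qed (use assms in auto)
  have "integral {a..b} ?E \<le> integral {a..b} (\<lambda>s. 1 / (1 + (s - x)\<^sup>2))"
  proof (rule integral_le)
    show "?E integrable_on {a..b}"
      by (intro integrable_continuous_interval continuous_intros)
    show "(\<lambda>s. 1 / (1 + (s - x)\<^sup>2)) integrable_on {a..b}"
      using hi by blast
    fix s assume "s \<in> {a..b}"
    have "1 + (s - x)\<^sup>2 \<le> exp ((s - x)\<^sup>2)" by (rule exp_ge_add_one_self)
    also have "\<dots> \<le> exp (A * (s - x)\<^sup>2)"
      using assms(2) mult_right_mono[of 1 A "(s - x)\<^sup>2"] by simp
    finally show "?E s \<le> 1 / (1 + (s - x)\<^sup>2)"
      by (simp add: exp_minus inverse_eq_divide frac_le add_pos_nonneg)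
  qed
  also have "\<dots> = arctan (b - x) - arctan (a - x)" using hi by (rule integral_unique)
  also have "\<dots> \<le> pi" using arctan_ubound[of "b - x"] arctan_lbound[of "a - x"] by simp
  finally show ?thesis .
qed

text \<open>\<open>H\<close> is the convolution of cis(-\<theta>) with the Gaussian exp(-A u^2),
  which extends to complex arguments. Neither bound depends on \<open>R\<close>, and this is what
  makes the final constant absolute.\<close>

lemma holomorphic_phase_approx:
  fixes \<theta> :: "real \<Rightarrow> real" and C A R :: real
  assumes lip: "\<And>x s. \<bar>\<theta> x - \<theta> s\<bar> \<le> C * \<bar>x - s\<bar>"
    and A: "A \<ge> 1" "C\<^sup>2 \<le> 2 * A" and R: "R \<ge> 0"
  obtains H where "H holomorphic_on strip"
    "\<And>w. w \<in> strip \<Longrightarrow> cmod (H w) \<le> pi * exp (A * (pi / 2)\<^sup>2)"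
    "\<And>x. 0 \<le> x \<Longrightarrow> x \<le> R \<Longrightarrow> exp (- A) \<le> Re (H (of_real x) * cis (\<theta> x))"
proof -
  have cont\<theta>: "continuous_on T \<theta>" for T
  proof -
    have "C \<ge> 0" using lip[of 1 0] by simp
    then have "C-lipschitz_on T \<theta>" using lip by (intro lipschitz_onI) (auto simp: dist_real_def)
    then show ?thesis by (rule lipschitz_on_continuous_on)
  qed
  define k where "k w s = cis (- \<theta> s) * exp (- of_real A * (w - of_real s)\<^sup>2)" for w :: complex and s
  \<comment> \<open>Integrating one unit beyond [0, R] on each side keeps the window [x - 1, x + 1]
    inside the range for every \<open>x\<close> in [0, R].\<close>
  define H where "H w = integral {-1..R + 1} (k w)" for w
  have cis: "continuous_on T (\<lambda>s. cis (- \<theta> s))" for T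
    unfolding cis_conv_exp by (intro continuous_intros cont\<theta>)
  have contk: "continuous_on T (k w)" for T w
    unfolding k_def by (intro continuous_intros cis)
  have intk: "k w integrable_on {-1..R + 1}" for w
    by (intro integrable_continuous_interval contk)
  have "(\<lambda>w. integral (cbox (-1) (R + 1)) (k w)) holomorphic_on strip"
  proof (rule leibniz_rule_holomorphic)
    fix w :: complex and s :: real
    show "((\<lambda>w. k w s) has_field_derivative
        cis (- \<theta> s) * (exp (- of_real A * (w - of_real s)\<^sup>2) * (- of_real A * (2 * (w - of_real s))))) (at w within strip)"
      unfolding k_def by (auto intro!: derivative_eq_intros)
    show "k w integrable_on cbox (-1) (R + 1)" using intk by simp
    show "continuous_on (strip \<times> cbox (-1) (R + 1)) (\<lambda>(w, s).
        cis (- \<theta> s) * (exp (- of_real A * (w - of_real s)\<^sup>2) * (- of_real A * (2 * (w - of_real s)))))"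
      unfolding split_beta
      by (intro continuous_intros continuous_on_compose2[OF cis[of UNIV]]) auto
  qed (rule convex_strip)
  then have 1: "H holomorphic_on strip" by (simp add: H_def[abs_def])
  have 2: "cmod (H w) \<le> pi * exp (A * (pi / 2)\<^sup>2)" if w: "w \<in> strip" for w
  proof -
    have "\<bar>Im w\<bar> \<le> pi / 2" using w by (simp add: strip_def)
    then have "\<bar>Im w\<bar>\<^sup>2 \<le> (pi / 2)\<^sup>2" by (intro power_mono) auto
    then have im: "A * (Im w)\<^sup>2 \<le> A * (pi / 2)\<^sup>2" using A(1) by (intro mult_left_mono) auto
    let ?B = "\<lambda>s. exp (A * (pi / 2)\<^sup>2) * exp (- A * (s - Re w)\<^sup>2)"
    have "cmod (H w) \<le> integral {-1..R + 1} ?B"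
      unfolding H_def
    proof (rule integral_norm_bound_integral[OF intk])
      show "?B integrable_on {-1..R + 1}"
        by (intro integrable_continuous_interval continuous_intros)
      fix s
      \<comment> \<open>The modulus of the complex Gaussian is the real Gaussian centred at
        \<open>Re w\<close> times exp(A (Im w)^2), and the latter factor is bounded on the
        strip.\<close>
      have "cmod (k w s) = exp (Re (- of_real A * (w - of_real s)\<^sup>2))"
        by (simp add: k_def norm_mult)
      also have "Re (- of_real A * (w - of_real s)\<^sup>2) = A * (Im w)\<^sup>2 + - A * (s - Re w)\<^sup>2"
        by (simp add: power2_eq_square algebra_simps)
      also have "exp \<dots> \<le> ?B s" using im by (simp add: exp_add[symmetric])
      finally show "cmod (k w s) \<le> ?B s" .
    qed
    also have "\<dots> = exp (A * (pi / 2)\<^sup>2) * integral {-1..R + 1} (\<lambda>s. exp (- A * (s - Re w)\<^sup>2))"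
      by (rule integral_mult_right)
    also have "\<dots> \<le> exp (A * (pi / 2)\<^sup>2) * pi"
      using gaussian_integral_upper[of "-1" "R + 1" A "Re w"] A R by (intro mult_left_mono) auto
    finally show ?thesis by (simp add: mult.commute)
  qed
  have 3: "exp (- A) \<le> Re (H (of_real x) * cis (\<theta> x))" if x: "0 \<le> x" "x \<le> R" for x
  proof -
    let ?f = "\<lambda>s. exp (- A * (s - x)\<^sup>2) * (1 - A * (s - x)\<^sup>2)"
    have "((\<lambda>s. Re (k (of_real x) s * cis (\<theta> x))) has_integral Re (H (of_real x) * cis (\<theta> x))) {-1..R + 1}"
      unfolding H_def
      by (intro has_integral_linear[OF _ bounded_linear_Re, unfolded o_def] has_integral_mult_left
          integrable_integral intk)
    moreover have "Re (k (of_real x) s * cis (\<theta> x)) = exp (- A * (s - x)\<^sup>2) * cos (\<theta> x - \<theta> s)" for s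
    proof -
      have "exp (- of_real A * (of_real x - of_real s)\<^sup>2) = (of_real (exp (- A * (s - x)\<^sup>2)) :: complex)"
        by (simp add: exp_of_real power2_commute flip: of_real_diff of_real_power of_real_mult of_real_minus)
      then have "k (of_real x) s * cis (\<theta> x) = of_real (exp (- A * (s - x)\<^sup>2)) * cis (\<theta> x - \<theta> s)"
        by (simp add: k_def cis_mult mult_ac)
      then show ?thesis by simp
    qed
    ultimately have hi: "((\<lambda>s. exp (- A * (s - x)\<^sup>2) * cos (\<theta> x - \<theta> s)) has_integral
        Re (H (of_real x) * cis (\<theta> x))) {-1..R + 1}" by simp
    have "exp (- A) \<le> integral {-1..R + 1} ?f"
      using gaussian_moment_lower[of "-1" x "R + 1" A] x A by simp
    also have "\<dots> \<le> Re (H (of_real x) * cis (\<theta> x))"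
    proof (rule has_integral_le[OF _ hi])
      show "(?f has_integral integral {-1..R + 1} ?f) {-1..R + 1}"
        by (intro integrable_integral integrable_continuous_interval continuous_intros)
      fix s
      \<comment> \<open>Here \<open>A\<close> is large enough: half the squared phase difference is
        at most A (s - x)^2, so the quadratic bound for the cosine applies.\<close>
      have "\<bar>\<theta> x - \<theta> s\<bar>\<^sup>2 \<le> (C * \<bar>x - s\<bar>)\<^sup>2" using lip by (intro power_mono) auto
      also have "\<dots> = C\<^sup>2 * (s - x)\<^sup>2" by (simp add: power_mult_distrib power2_commute)
      also have "\<dots> \<le> 2 * A * (s - x)\<^sup>2" using A(2) by (intro mult_right_mono) auto
      finally have "1 - A * (s - x)\<^sup>2 \<le> cos (\<theta> x - \<theta> s)"
        using cos_ge_one_minus_half_square[of "\<theta> x - \<theta> s"] by simp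
      then show "?f s \<le> exp (- A * (s - x)\<^sup>2) * cos (\<theta> x - \<theta> s)" by simp
    qed
    finally show ?thesis .
  qed
  show ?thesis by (rule that[OF 1 2 3])
qed

section \<open>Curve length and the upper bound\<close>

lemma partition_points_mono:
  assumes "partition_points n t" "i \<le> j" "j \<le> n"
  shows "t i \<le> t j"
  using assms(2,3)
proof (induction j rule: dec_induct)
  case (step j)
  then have "t i \<le> t j" "j < n" by auto
  moreover have "t j \<le> t (Suc j)"
    using assms(1) \<open>j < n\<close> by (simp add: partition_points_def)
  ultimately show ?case by linarith
qed simp

text \<open>The function \<open>\<Phi>\<close> acts as an arc-length majorant: its increments
  telescope over every partition.\<close>

lemma curve_length_le:
  assumes "\<And>s t. 0 \<le> s \<Longrightarrow> s \<le> t \<Longrightarrow> t \<le> 1 \<Longrightarrow> dist (g s) (g t) \<le> \<Phi> t - \<Phi> s"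
  shows "curve_length g \<le> ereal (\<Phi> 1 - \<Phi> 0)"
  unfolding curve_length_def
proof (rule Sup_least, clarify)
  fix n t assume part: "partition_points n t"
  then have ends: "t 0 = 0" "t n = 1" by (auto simp: partition_points_def)
  have "(\<Sum>i<n. dist (g (t i)) (g (t (Suc i)))) \<le> (\<Sum>i<n. \<Phi> (t (Suc i)) - \<Phi> (t i))"
  proof (rule sum_mono)
    fix i assume "i \<in> {..<n}"
    then show "dist (g (t i)) (g (t (Suc i))) \<le> \<Phi> (t (Suc i)) - \<Phi> (t i)"
      using partition_points_mono[OF part, of 0 i] partition_points_mono[OF part, of i "Suc i"]
        partition_points_mono[OF part, of "Suc i" n] ends
      by (intro assms) auto
  qed
  also have "\<dots> = \<Phi> 1 - \<Phi> 0" using sum_lessThan_telescope[of "\<lambda>i. \<Phi> (t i)" n] by (simp add: ends)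
  finally show "ereal (\<Sum>i<n. dist (g (t i)) (g (t (Suc i)))) \<le> ereal (\<Phi> 1 - \<Phi> 0)" by simp
qed

lemma interior_dist_le:
  assumes "path g" "path_image g \<subseteq> \<Omega>" "pathstart g = p" "pathfinish g = q"
    and "\<And>s t. 0 \<le> s \<Longrightarrow> s \<le> t \<Longrightarrow> t \<le> 1 \<Longrightarrow> dist (g s) (g t) \<le> \<Phi> t - \<Phi> s"
  shows "interior_dist \<Omega> p q \<le> ereal (\<Phi> 1 - \<Phi> 0)"
proof -
  have le: "curve_length g \<le> ereal (\<Phi> 1 - \<Phi> 0)" by (rule curve_length_le) (rule assms(5))
  then have "curve_length g < \<infinity>" by (rule order_le_less_trans) simp
  then have "interior_dist \<Omega> p q \<le> curve_length g"
    unfolding interior_dist_def rectifiable_def using assms(1-4) by (intro Inf_lower) auto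
  then show ?thesis using le by (rule order_trans)
qed

text \<open>By compactness the path can be cut into equal parameter steps whose consecutive points
  share a ball inside \<open>\<Omega>\<close>. Balls are convex, so \<open>f\<close> is 1-Lipschitz
  on each, and the increments add up to at most one polygonal sum.\<close>

lemma cmod_diff_le_curve_length:
  assumes "open \<Omega>" "f holomorphic_on \<Omega>" "\<And>z. z \<in> \<Omega> \<Longrightarrow> cmod (deriv f z) \<le> 1"
    and g: "path g" "path_image g \<subseteq> \<Omega>"
  shows "ereal (cmod (f (pathstart g) - f (pathfinish g))) \<le> curve_length g"
proof -
  obtain e where e: "e > 0" "(\<Union>x\<in>path_image g. ball x e) \<subseteq> \<Omega>"
    using compact_subset_open_imp_ball_epsilon_subset[OF compact_path_image[OF g(1)] assms(1) g(2)] by metis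
  have "uniformly_continuous_on {0..1} g"
    using g(1) by (intro compact_uniformly_continuous) (auto simp: path_def)
  then obtain d where d: "d > 0"
    "\<And>s t. s \<in> {0..1} \<Longrightarrow> t \<in> {0..1} \<Longrightarrow> dist t s < d \<Longrightarrow> dist (g t) (g s) < e"
    unfolding uniformly_continuous_on_def using e(1) by metis
  obtain n :: nat where "n > 1 / d" using reals_Archimedean2 by blast
  moreover from this d(1) have "n > 0"
    by (metis less_asym of_nat_0 zero_less_divide_1_iff neq0_conv)
  ultimately have n: "n > 0" "1 / n < d"
    using d(1) by (auto simp: field_simps)
  define t where "t i = real i / real n" for i :: nat
  have part: "partition_points n t"
    using n(1) by (auto simp: partition_points_def t_def divide_right_mono)
  have step: "cmod (f (g (t i)) - f (g (t (Suc i)))) \<le> dist (g (t i)) (g (t (Suc i)))" if "i < n" for i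
  proof -
    have t01: "t i \<in> {0..1}" "t (Suc i) \<in> {0..1}"
      using that by (auto simp: t_def)
    have "dist (t (Suc i)) (t i) = 1 / n"
      using n(1) by (simp add: t_def dist_real_def diff_divide_distrib[symmetric])
    then have near: "g (t (Suc i)) \<in> ball (g (t i)) e"
      using d(2)[OF t01] n(2) by (simp add: dist_commute)
    have sub: "ball (g (t i)) e \<subseteq> \<Omega>"
    proof -
      have "g (t i) \<in> path_image g" using t01(1) by (simp add: path_image_def)
      with e(2) show ?thesis by blast
    qed
    have "cmod (f (g (t i)) - f (g (t (Suc i)))) \<le> 1 * cmod (g (t i) - g (t (Suc i)))"
    proof (rule field_differentiable_bound[where S = "ball (g (t i)) e"])
      fix z assume "z \<in> ball (g (t i)) e"
      then have "z \<in> \<Omega>" using sub by blast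
      then show "(f has_field_derivative deriv f z) (at z within ball (g (t i)) e)"
        "cmod (deriv f z) \<le> 1"
        using holomorphic_derivI[OF assms(2,1)] assms(3) by (auto intro: has_field_derivative_at_within)
    qed (use near e(1) in auto)
    then show ?thesis by (simp add: dist_norm)
  qed
  have "f (pathfinish g) - f (pathstart g) = (\<Sum>i<n. f (g (t (Suc i))) - f (g (t i)))"
    using part sum_lessThan_telescope[of "\<lambda>i. f (g (t i))" n]
    by (simp add: partition_points_def pathstart_def pathfinish_def)
  then have "cmod (f (pathstart g) - f (pathfinish g)) = cmod (\<Sum>i<n. f (g (t (Suc i))) - f (g (t i)))"
    by (simp add: norm_minus_commute)
  also have "\<dots> \<le> (\<Sum>i<n. dist (g (t i)) (g (t (Suc i))))"
    using step by (intro sum_norm_le) (simp add: norm_minus_commute)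
  finally have "ereal (cmod (f (pathstart g) - f (pathfinish g))) \<le>
      ereal (\<Sum>i<n. dist (g (t i)) (g (t (Suc i))))" by simp
  also have "\<dots> \<le> curve_length g"
    unfolding curve_length_def using part by (intro Sup_upper) blast
  finally show ?thesis .
qed

lemma analytic_dist_le_interior_dist:
  assumes "open \<Omega>"
  shows "analytic_dist \<Omega> p q \<le> interior_dist \<Omega> p q"
  unfolding analytic_dist_def interior_dist_def
proof (rule Sup_least, rule Inf_greatest, clarify)
  fix f g assume "f analytic_on \<Omega>" "\<forall>z\<in>\<Omega>. cmod (deriv f z) \<le> 1"
    and "rectifiable g" "path_image g \<subseteq> \<Omega>"
  then show "ereal (cmod (f (pathstart g) - f (pathfinish g))) \<le> curve_length g"
    using assms by (intro cmod_diff_le_curve_length)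
      (auto simp: analytic_on_open rectifiable_def)
qed

section \<open>The lower bound\<close>

text \<open>The plane has no Riemann map onto the strip, but the straight segment and the identity
  function already give the constant 1.\<close>

lemma interior_dist_le_analytic_dist_UNIV: "interior_dist UNIV p q \<le> analytic_dist UNIV p q"
proof -
  have "interior_dist UNIV p q \<le> ereal (dist p q * 1 - dist p q * 0)"
  proof (rule interior_dist_le)
    show "path (linepath p q)" "path_image (linepath p q) \<subseteq> UNIV"
      "pathstart (linepath p q) = p" "pathfinish (linepath p q) = q" by auto
    fix s t :: real assume "s \<le> t"
    have "linepath p q s - linepath p q t = of_real (t - s) * (p - q)"
      by (simp add: linepath_def scaleR_conv_of_real algebra_simps)
    then show "dist (linepath p q s) (linepath p q t) \<le> dist p q * t - dist p q * s"
      using \<open>s \<le> t\<close> unfolding dist_norm by (simp only: norm_mult norm_of_real) (simp add: algebra_simps)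
  qed
  also have "\<dots> \<le> analytic_dist UNIV p q"
    unfolding analytic_dist_def dist_norm
    by (rule Sup_upper) (intro CollectI exI[of _ "\<lambda>z. z"], simp)
  finally show ?thesis .
qed

text \<open>The competing curve is the image of [0, R] under \<open>\<psi>\<close>, with the
  integral of |\<psi>'| as its arc-length majorant.\<close>

lemma interior_dist_le_integral_deriv:
  fixes \<psi> :: "complex \<Rightarrow> complex"
  assumes hol: "\<psi> holomorphic_on S" and "open S" and real: "\<And>x. complex_of_real x \<in> S"
    and sub: "\<psi> ` S \<subseteq> \<Omega>" and "R \<ge> 0"
  shows "interior_dist \<Omega> (\<psi> 0) (\<psi> (of_real R)) \<le>
    ereal (integral {0..R} (\<lambda>x. cmod (deriv \<psi> (of_real x))))"
proof -
  let ?g = "\<lambda>x. deriv \<psi> (complex_of_real x)"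
  have cont: "continuous_on T ?g" for T
    by (rule continuous_on_compose2[OF holomorphic_on_imp_continuous_on[OF holomorphic_deriv[OF hol \<open>open S\<close>]]])
       (intro continuous_intros, use real in auto)
  have int: "?g integrable_on {a..b}" "(\<lambda>x. cmod (?g x)) integrable_on {a..b}" for a b
    by (intro integrable_continuous_interval continuous_intros cont)+
  define \<gamma> where "\<gamma> t = \<psi> (of_real (R * t))" for t
  define \<Phi> where "\<Phi> t = integral {0..R * t} (\<lambda>x. cmod (?g x))" for t
  have "interior_dist \<Omega> (\<psi> 0) (\<psi> (of_real R)) \<le> ereal (\<Phi> 1 - \<Phi> 0)"
  proof (rule interior_dist_le)
    show "path \<gamma>"
      unfolding path_def \<gamma>_def
      by (rule continuous_on_compose2[OF holomorphic_on_imp_continuous_on[OF hol]])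
         (intro continuous_intros, use real in \<open>auto simp del: of_real_mult\<close>)
    show "path_image \<gamma> \<subseteq> \<Omega>"
      using sub real by (auto simp: path_image_def \<gamma>_def simp del: of_real_mult)
    show "pathstart \<gamma> = \<psi> 0" "pathfinish \<gamma> = \<psi> (of_real R)"
      by (auto simp: pathstart_def pathfinish_def \<gamma>_def)
    fix s t :: real assume st: "0 \<le> s" "s \<le> t"
    then have le: "R * s \<le> R * t" "0 \<le> R * s" using \<open>R \<ge> 0\<close> by (auto intro: mult_left_mono)
    have "(?g has_integral \<psi> (of_real (R * t)) - \<psi> (of_real (R * s))) {R * s..R * t}"
      by (rule fundamental_theorem_of_calculus[OF le(1)], rule has_vector_derivative_real_field)
         (rule holomorphic_derivI[OF hol \<open>open S\<close> real])
    then have "\<gamma> t - \<gamma> s = integral {R * s..R * t} ?g"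
      by (simp add: \<gamma>_def integral_unique)
    then have "dist (\<gamma> s) (\<gamma> t) = cmod (integral {R * s..R * t} ?g)"
      by (metis dist_commute dist_norm)
    also have "\<dots> \<le> integral {R * s..R * t} (\<lambda>x. cmod (?g x))"
      by (intro integral_norm_bound_integral int) auto
    also have "\<dots> = \<Phi> t - \<Phi> s"
      unfolding \<Phi>_def using Henstock_Kurzweil_Integration.integral_combine[OF le(2,1) int(2)] by simp
    finally show "dist (\<gamma> s) (\<gamma> t) \<le> \<Phi> t - \<Phi> s" .
  qed
  then show ?thesis by (simp add: \<Phi>_def)
qed

text \<open>The derivative of the injective \<open>\<psi>\<close> has no zeros on the simply
  connected strip, so it has a holomorphic logarithm \<open>L\<close>. Its imaginary part on the
  real line is the phase, and L' = \<psi>''/\<psi>' is bounded there by \<open>C\<close>.\<close>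

lemma phase_lipschitz:
  assumes C: "\<And>f x. f holomorphic_on ball x 1 \<Longrightarrow> inj_on f (ball x 1) \<Longrightarrow>
       cmod (deriv (deriv f) x) \<le> C * cmod (deriv f x)"
    and hol: "\<psi> holomorphic_on strip" and inj: "inj_on \<psi> strip"
  obtains \<theta> :: "real \<Rightarrow> real" where
    "\<And>x s. \<bar>\<theta> x - \<theta> s\<bar> \<le> C * \<bar>x - s\<bar>"
    "\<And>x. deriv \<psi> (of_real x) = of_real (cmod (deriv \<psi> (of_real x))) * cis (\<theta> x)"
proof -
  define g where "g = deriv \<psi>"
  have holg: "g holomorphic_on strip"
    unfolding g_def by (rule holomorphic_deriv[OF hol open_strip])
  have g0: "g w \<noteq> 0" if "w \<in> strip" for w
    unfolding g_def by (rule holomorphic_injective_imp_regular[OF hol open_strip inj that])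
  obtain L where L: "L holomorphic_on strip" "\<And>w. w \<in> strip \<Longrightarrow> g w = exp (L w)"
    using simply_connected_eq_holomorphic_log[OF open_strip] convex_imp_simply_connected[OF convex_strip]
      holg g0 by metis
  have dL: "(L has_field_derivative deriv L w) (at w)" if "w \<in> strip" for w
    by (rule holomorphic_derivI[OF L(1) open_strip that])
  have bound: "cmod (deriv L (of_real x)) \<le> C" for x
  proof -
    let ?x = "complex_of_real x"
    have "((\<lambda>w. exp (L w)) has_field_derivative exp (L ?x) * deriv L ?x) (at ?x)"
      by (auto intro!: derivative_eq_intros dL)
    then have "(g has_field_derivative g ?x * deriv L ?x) (at ?x)"
      using L(2)[of ?x] has_field_derivative_transform_within_open[OF _ open_strip of_real_in_strip, of "\<lambda>w. exp (L w)" _ x g] L(2)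
      by simp
    then have "deriv g ?x = g ?x * deriv L ?x" by (rule DERIV_imp_deriv)
    moreover have "cmod (deriv g ?x) \<le> C * cmod (g ?x)"
      unfolding g_def using ball_of_real_subset_strip
      by (intro C holomorphic_on_subset[OF hol] inj_on_subset[OF inj])
    ultimately show ?thesis
      using g0[of ?x] by (simp add: norm_mult mult.commute)
  qed
  show ?thesis
  proof
    fix x s :: real
    have "\<bar>Im (L (of_real x)) - Im (L (of_real s))\<bar> \<le> cmod (L (of_real x) - L (of_real s))"
      using abs_Im_le_cmod[of "L (of_real x) - L (of_real s)"] by simp
    \<comment> \<open>The mean value inequality is taken on the convex set of reals, because L' is
      controlled only there.\<close>
    also have "\<dots> \<le> C * cmod (of_real x - of_real s)"
      by (rule field_differentiable_bound[OF convex_Reals, of L "deriv L"])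
         (use bound in \<open>auto simp: Reals_def intro!: has_field_derivative_at_within dL\<close>)
    finally show "\<bar>Im (L (of_real x)) - Im (L (of_real s))\<bar> \<le> C * \<bar>x - s\<bar>"
      by (simp flip: of_real_diff)
    show "deriv \<psi> (of_real x) = of_real (cmod (deriv \<psi> (of_real x))) * cis (Im (L (of_real x)))"
      using L(2)[of "of_real x"] by (simp add: g_def norm_exp_eq_Re exp_eq_polar[symmetric])
  qed
qed

lemma interior_dist_le_analytic_dist:
  obtains c :: real where "c > 0"
    "\<And>\<Omega> p q. open \<Omega> \<Longrightarrow> simply_connected \<Omega> \<Longrightarrow> \<Omega> \<noteq> UNIV \<Longrightarrow> p \<in> \<Omega> \<Longrightarrow> q \<in> \<Omega> \<Longrightarrow>
       ereal c * interior_dist \<Omega> p q \<le> analytic_dist \<Omega> p q"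
proof -
  obtain C :: real where C: "\<And>f x. f holomorphic_on ball x 1 \<Longrightarrow> inj_on f (ball x 1) \<Longrightarrow>
       cmod (deriv (deriv f) x) \<le> C * cmod (deriv f x)"
    using univalent_deriv2_bound by metis
  \<comment> \<open>Meets both requirements of the smoothing step, \<open>A \<ge> 1\<close> and
    \<open>C\<^sup>2 \<le> 2 * A\<close>, and depends on \<open>C\<close> alone.\<close>
  define A where "A = 1 + C\<^sup>2"
  define M where "M = pi * exp (A * (pi / 2)\<^sup>2)"
  have M: "M > 0" by (simp add: M_def)
  have bound: "ereal (exp (- A) / M) * interior_dist \<Omega> p q \<le> analytic_dist \<Omega> p q"
    if \<Omega>: "open \<Omega>" "simply_connected \<Omega>" "\<Omega> \<noteq> UNIV" "p \<in> \<Omega>" "q \<in> \<Omega>" for \<Omega> p q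
  proof -
    obtain \<sigma> \<psi> R where \<sigma>: "\<sigma> holomorphic_on \<Omega>" and \<psi>: "\<psi> holomorphic_on strip"
      and \<sigma>\<psi>: "\<And>z. z \<in> \<Omega> \<Longrightarrow> \<sigma> z \<in> strip \<and> \<psi> (\<sigma> z) = z"
        "\<And>w. w \<in> strip \<Longrightarrow> \<psi> w \<in> \<Omega> \<and> \<sigma> (\<psi> w) = w"
      and R: "R \<ge> 0" "\<psi> 0 = p" "\<psi> (of_real R) = q"
      using Riemann_map_strip[OF \<Omega>] by metis
    have "inj_on \<psi> strip" using \<sigma>\<psi>(2) by (metis inj_onI)
    then obtain \<theta> where \<theta>: "\<And>x s. \<bar>\<theta> x - \<theta> s\<bar> \<le> C * \<bar>x - s\<bar>"
      "\<And>x. deriv \<psi> (of_real x) = of_real (cmod (deriv \<psi> (of_real x))) * cis (\<theta> x)"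
      using phase_lipschitz[OF C \<psi>] by blast
    have A: "A \<ge> 1" "C\<^sup>2 \<le> 2 * A" by (auto simp: A_def)
    obtain H where H: "H holomorphic_on strip" "\<And>w. w \<in> strip \<Longrightarrow> cmod (H w) \<le> M"
      "\<And>x. 0 \<le> x \<Longrightarrow> x \<le> R \<Longrightarrow> exp (- A) \<le> Re (H (of_real x) * cis (\<theta> x))"
      using holomorphic_phase_approx[OF \<theta>(1) A R(1)] unfolding M_def by metis
    have "(\<lambda>z. H (\<sigma> z)) holomorphic_on \<Omega>"
      using holomorphic_on_compose_gen[OF \<sigma> H(1)] \<sigma>\<psi>(1) by (auto simp: o_def)
    then obtain F where F: "\<And>z. z \<in> \<Omega> \<Longrightarrow> (F has_field_derivative H (\<sigma> z)) (at z)"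
      using simply_connected_eq_global_primitive[OF \<Omega>(1)] \<Omega>(2) by metis
    let ?g = "\<lambda>x. deriv \<psi> (complex_of_real x)"
    define I where "I = integral {0..R} (\<lambda>x. cmod (?g x))"
    have "continuous_on {0..R} ?g"
      by (rule continuous_on_compose2[OF holomorphic_on_imp_continuous_on[OF holomorphic_deriv[OF \<psi> open_strip]]])
         (intro continuous_intros, auto)
    then have "((\<lambda>x. cmod (?g x)) has_integral I) {0..R}"
      unfolding I_def by (intro integrable_integral integrable_continuous_interval continuous_intros)
    then have int: "((\<lambda>x. exp (- A) * cmod (?g x)) has_integral exp (- A) * I) {0..R}"
      by (rule has_integral_mult_right)
    \<comment> \<open>By the chain rule the derivative of F(\<psi> w) is H(\<sigma>(\<psi> w))
      \<psi>'(w), and \<sigma> undoes \<psi>.\<close>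
    have "((\<lambda>x. H (of_real x) * ?g x) has_integral F (\<psi> (of_real R)) - F (\<psi> (of_real 0))) {0..R}"
    proof (rule fundamental_theorem_of_calculus[OF R(1)], rule has_vector_derivative_real_field)
      fix x :: real
      show "((\<lambda>w. F (\<psi> w)) has_field_derivative H (of_real x) * ?g x) (at (of_real x))"
        using DERIV_chain2[OF F holomorphic_derivI[OF \<psi> open_strip of_real_in_strip]] \<sigma>\<psi>(2)[of "of_real x"]
        by (metis of_real_in_strip)
    qed
    from has_integral_linear[OF this bounded_linear_Re]
    have "((\<lambda>x. Re (H (of_real x) * ?g x)) has_integral Re (F q - F p)) {0..R}"
      using R by (simp add: o_def)
    with int have "exp (- A) * I \<le> Re (F q - F p)"
    proof (rule has_integral_le)
      fix x assume x: "x \<in> {0..R}"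
      have "H (of_real x) * ?g x = of_real (cmod (?g x)) * (H (of_real x) * cis (\<theta> x))"
        using \<theta>(2)[of x] by (metis mult.left_commute)
      then have "Re (H (of_real x) * ?g x) = cmod (?g x) * Re (H (of_real x) * cis (\<theta> x))"
        by (simp only: Re_complex_of_real Im_complex_of_real times_complex.sel mult_zero_left diff_zero)
      moreover have "exp (- A) * cmod (?g x) \<le> Re (H (of_real x) * cis (\<theta> x)) * cmod (?g x)"
        using H(3)[of x] x by (intro mult_right_mono) auto
      ultimately show "exp (- A) * cmod (?g x) \<le> Re (H (of_real x) * ?g x)"
        by (metis mult.commute)
    qed
    also have "\<dots> \<le> cmod (F q - F p)" by (rule complex_Re_le_cmod)
    finally have FI: "exp (- A) / M * I \<le> cmod (F p / M - F q / M)"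
      using M by (simp add: norm_minus_commute norm_divide divide_right_mono flip: diff_divide_distrib)
    have "interior_dist \<Omega> p q \<le> ereal I"
      using interior_dist_le_integral_deriv[OF \<psi> open_strip of_real_in_strip _ R(1)] \<sigma>\<psi>(2) R
      by (auto simp: I_def image_subset_iff)
    then have "ereal (exp (- A) / M) * interior_dist \<Omega> p q \<le> ereal (exp (- A) / M) * ereal I"
      using M by (intro ereal_mult_left_mono) auto
    also have "\<dots> \<le> ereal (cmod (F p / M - F q / M))" using FI by simp
    \<comment> \<open>Division by \<open>M\<close> turns the primitive \<open>F\<close> into an
      admissible competitor, since |F'| = |H(\<sigma> z)| \<le> \<open>M\<close>.\<close>
    also have "\<dots> \<le> analytic_dist \<Omega> p q"
      unfolding analytic_dist_def
    proof (rule Sup_upper, intro CollectI exI[of _ "\<lambda>z. F z / M"] conjI refl ballI)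
      have dF: "((\<lambda>z. F z / M) has_field_derivative H (\<sigma> z) / M) (at z)" if "z \<in> \<Omega>" for z
        by (intro DERIV_cdivide F that)
      then show "(\<lambda>z. F z / M) analytic_on \<Omega>"
        using \<Omega>(1) by (auto simp: analytic_on_open holomorphic_on_open)
      fix z assume z: "z \<in> \<Omega>"
      show "cmod (deriv (\<lambda>z. F z / M) z) \<le> 1"
        using DERIV_imp_deriv[OF dF[OF z]] H(2) \<sigma>\<psi>(1)[OF z] M by (simp add: norm_divide)
    qed
    finally show ?thesis .
  qed
  show ?thesis
    by (rule that[OF _ bound]) (use M in auto)
qed

theorem theorem1p2:
  "\<exists>c::real. c > 0 \<and>
     (\<forall>\<Omega> p q. is_domain \<Omega> \<and> simply_connected \<Omega> \<and> p \<in> \<Omega> \<and> q \<in> \<Omega> \<longrightarrow>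
        ereal c * interior_dist \<Omega> p q \<le> analytic_dist \<Omega> p q \<and>
        analytic_dist \<Omega> p q \<le> interior_dist \<Omega> p q)"
proof -
  obtain c :: real where c: "c > 0"
    "\<And>\<Omega> p q. open \<Omega> \<Longrightarrow> simply_connected \<Omega> \<Longrightarrow> \<Omega> \<noteq> UNIV \<Longrightarrow> p \<in> \<Omega> \<Longrightarrow> q \<in> \<Omega> \<Longrightarrow>
       ereal c * interior_dist \<Omega> p q \<le> analytic_dist \<Omega> p q"
    using interior_dist_le_analytic_dist by blast
  \<comment> \<open>Extended reals allow lowering the constant to \<open>min c 1\<close> only
    against a nonnegative factor. The one-step partition already bounds every curve length below by
    a nonnegative number.\<close>
  have nonneg: "interior_dist \<Omega> p q \<ge> 0" for \<Omega> p q
    unfolding interior_dist_def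
  proof (rule Inf_greatest, clarify)
    fix g :: "real \<Rightarrow> complex"
    have "ereal (\<Sum>i<1. dist (g (real i)) (g (real (Suc i)))) \<le> curve_length g"
      unfolding curve_length_def
      by (rule Sup_upper) (auto simp: partition_points_def intro!: exI[of _ "1::nat"] exI[of _ real])
    then show "0 \<le> curve_length g"
      by (rule order_trans[rotated]) simp
  qed
  have "ereal (min c 1) * interior_dist \<Omega> p q \<le> analytic_dist \<Omega> p q"
    if "is_domain \<Omega>" "simply_connected \<Omega>" "p \<in> \<Omega>" "q \<in> \<Omega>" for \<Omega> p q
  proof (cases "\<Omega> = UNIV")
    case True
    have "ereal (min c 1) * interior_dist \<Omega> p q \<le> ereal 1 * interior_dist \<Omega> p q"
      by (intro ereal_mult_right_mono nonneg) simp
    also have "\<dots> \<le> analytic_dist \<Omega> p q"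
      using interior_dist_le_analytic_dist_UNIV True by simp
    finally show ?thesis .
  next
    case False
    have "ereal (min c 1) * interior_dist \<Omega> p q \<le> ereal c * interior_dist \<Omega> p q"
      by (intro ereal_mult_right_mono nonneg) simp
    also have "\<dots> \<le> analytic_dist \<Omega> p q"
      using c(2) False that by (simp add: is_domain_def)
    finally show ?thesis .
  qed
  then show ?thesis
    using analytic_dist_le_interior_dist c(1)
    by (intro exI[of _ "min c 1"]) (auto simp: is_domain_def)
qed

end
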